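(* Let $\alpha,\beta_0,\beta_1$ be positive integers, let $d\ge 2$ be an integer, and let $$\sigma=\frac{\beta_0-\alpha}{\beta_1}+\frac{L_d(\alpha)}{\beta_1F_d(\alpha)}.$$ Then $\sigma$ is the half of an odd integer if and only if one of the following conditions holds: (1) $d=3$, $\alpha=1$ and $(\beta_0+1)/\beta_1$ is the half of an odd integer; (2) $d=2$, $\alpha=1$ and $(\beta_0+2)/\beta_1$ is the half of an odd integer; (3) $d=2$, $\alpha=2$ and $(\beta_0+1)/\beta_1$ is the half of an odd integer; (4) $d=2$, $\alpha=4$ and $(2\beta_0+1)/\beta_1$ is an integer.
   Context: The Fibonacci polynomials $F_n(q)$ and Lucas polynomials $L_n(q)$ are defined by $F_0(q)=0$, $F_1(q)=1$, $L_0(q)=2$, $L_1(q)=q$ and the common recurrence $X_n(q)=qX_{n-1}(q)+X_{n-2}(q)$ for $n\ge2$, $X\in\{F,L\}$. "Half of an odd integer" means a number of the form $m/2$ with $m$ an odd integer. *)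

theory Defs
  imports Complex_Main "HOL-Computational_Algebra.Polynomial"
begin

fun fib_poly :: "nat \<Rightarrow> int poly" where
  "fib_poly 0 = 0"
| "fib_poly (Suc 0) = 1"
| "fib_poly (Suc (Suc n)) = [:0, 1:] * fib_poly (Suc n) + fib_poly n"

fun lucas_poly :: "nat \<Rightarrow> int poly" where
  "lucas_poly 0 = 2"
| "lucas_poly (Suc 0) = [:0, 1:]"
| "lucas_poly (Suc (Suc n)) = [:0, 1:] * lucas_poly (Suc n) + lucas_poly n"

definition half_odd_integer :: "real \<Rightarrow> bool" where
  "half_odd_integer x \<longleftrightarrow> (\<exists>m::int. odd m \<and> x = of_int m / 2)"

end

theory Submission
  imports Defs
begin

text \<open>
  Since \<open>L\<^sub>d(q) = q F\<^sub>d(q) + 2 F\<^sub>d\<^sub>-\<^sub>1(q)\<close>, we have \<open>\<sigma> = (\<beta>\<^sub>0 + 2 F\<^sub>d\<^sub>-\<^sub>1(\<alpha>) / F\<^sub>d(\<alpha>)) / \<beta>\<^sub>1\<close>. If \<open>2 \<sigma>\<close> is an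
  integer, then \<open>F\<^sub>d(\<alpha>)\<close> divides \<open>4 F\<^sub>d\<^sub>-\<^sub>1(\<alpha>)\<close>, hence divides 4 because consecutive values are
  coprime. By growth, this leaves \<open>d = 2\<close> with \<open>\<alpha> \<in> {1, 2, 4}\<close>, and \<open>d = 3\<close> with \<open>\<alpha> = 1\<close>.
\<close>

text \<open>Both sides satisfy the common two-term recurrence, so agreement at the first two indices
  suffices.\<close>

lemma lucas_poly_Suc: "lucas_poly (Suc n) = [:0, 1:] * fib_poly (Suc n) + 2 * fib_poly n"
proof (induction n rule: fib_poly.induct)
  case (3 n)
  then show ?case by (simp only: lucas_poly.simps fib_poly.simps) (simp add: algebra_simps)
qed simp_all

text \<open>The recurrence is a Euclidean step: subtracting \<open>a\<close> times the middle value
  from the newest leaves the oldest, so the gcd does not change.\<close>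

lemma coprime_poly_fib_poly_Suc:
  "coprime (poly (fib_poly (Suc n)) a) (poly (fib_poly n) a)"
proof (induction n)
  case (Suc n)
  then show ?case
    by (simp add: coprime_iff_gcd_eq_1 gcd_add_mult gcd.commute)
qed simp

lemma poly_fib_poly_nonneg: "a \<ge> 0 \<Longrightarrow> poly (fib_poly n) a \<ge> 0"
  by (induction n rule: fib_poly.induct) simp_all

lemma poly_fib_poly_le_Suc:
  assumes "a > 0"
  shows "poly (fib_poly n) a \<le> poly (fib_poly (Suc n)) a"
proof (cases n)
  case (Suc m)
  have "poly (fib_poly n) a \<le> a * poly (fib_poly n) a"
    using assms poly_fib_poly_nonneg[of a n] by (simp add: mult_le_cancel_right1)
  then show ?thesis
    using Suc assms poly_fib_poly_nonneg[of a m] by simp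
qed simp

lemma poly_fib_poly_pos: "a > 0 \<Longrightarrow> n > 0 \<Longrightarrow> poly (fib_poly n) a > 0"
proof (induction n)
  case (Suc n)
  then show ?case
    using poly_fib_poly_le_Suc[of a n] by (cases n) auto
qed simp

text \<open>The bound by 4 settles everything except two small exceptions: the value 3 at
  \<open>d = 2\<close>, \<open>a = 3\<close> and at \<open>d = 4\<close>, \<open>a = 1\<close>,
  where divisibility itself is needed.\<close>

lemma poly_fib_poly_dvd_4_cases:
  assumes "a > 0" "d \<ge> 2" and dvd: "poly (fib_poly d) a dvd 4"
  shows "d = 3 \<and> a = 1 \<or> d = 2 \<and> a \<in> {1, 2, 4}"
proof -
  have le4: "poly (fib_poly d) a \<le> 4"
    using dvd by (auto intro: zdvd_imp_le)
  consider "d = 2" | "d = 3" | "d = 4" | "d \<ge> 5" using assms(2) by linarith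
  then show ?thesis
  proof cases
    case 1
    then have "poly (fib_poly d) a = a" by (simp add: numeral_eq_Suc)
    then have "a \<in> {1, 2, 3, 4}" "a dvd 4" using assms(1) le4 dvd by auto
    then show ?thesis using 1 by auto
  next
    case 2
    then have eq: "poly (fib_poly d) a = a * a + 1" by (simp add: numeral_eq_Suc)
    have "a = 1"
    proof (rule ccontr)
      assume "a \<noteq> 1"
      then have "a \<ge> 2" using assms(1) by simp
      then have "2 * 2 \<le> a * a" by (intro mult_mono) auto
      then show False using eq le4 by simp
    qed
    then show ?thesis using 2 by simp
  next
    case 3
    then have eq: "poly (fib_poly d) a = a * (a * a + 1) + a"
      by (simp add: numeral_eq_Suc algebra_simps)
    have "a = 1"
    proof (rule ccontr)
      assume "a \<noteq> 1"
      then have "a \<ge> 2" using assms(1) by simp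
      moreover from this have "2 * 2 \<le> a * a" by (intro mult_mono) auto
      ultimately have "2 * 5 \<le> a * (a * a + 1)" by (intro mult_mono) auto
      then show False using eq le4 \<open>a \<ge> 2\<close> by simp
    qed
    then show ?thesis using eq dvd by simp
  next
    case 4
    \<comment> \<open>The value at index 5 is already at least 1 + 3 + 1 = 5, and monotonicity in
      the index carries this bound to \<open>d\<close>.\<close>
    have "1 \<le> a * a" using mult_mono[of 1 a 1 a] assms(1) by simp
    moreover from this have "1 * 1 \<le> (a * a) * (a * a)" by (intro mult_mono) auto
    moreover have "poly (fib_poly 5) a = (a * a) * (a * a) + 3 * (a * a) + 1"
      by (simp add: numeral_eq_Suc algebra_simps)
    ultimately have "5 \<le> poly (fib_poly 5) a" by simp
    also have "\<dots> \<le> poly (fib_poly d) a"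
      using 4 poly_fib_poly_le_Suc[OF assms(1)]
      by (rule lift_Suc_mono_le[where f = "\<lambda>n. poly (fib_poly n) a", rotated])
    finally show ?thesis using le4 by simp
  qed
qed

theorem theorem5p1:
  fixes \<alpha> \<beta>0 \<beta>1 :: int and d :: nat and \<sigma> :: real
  assumes "\<alpha> > 0" and "\<beta>0 > 0" and "\<beta>1 > 0" and "d \<ge> 2"
    and "\<sigma> = (of_int \<beta>0 - of_int \<alpha>) / of_int \<beta>1
           + of_int (poly (lucas_poly d) \<alpha>) / (of_int \<beta>1 * of_int (poly (fib_poly d) \<alpha>))"
  shows "half_odd_integer \<sigma> \<longleftrightarrow>
      (d = 3 \<and> \<alpha> = 1 \<and> half_odd_integer ((of_int \<beta>0 + 1) / of_int \<beta>1))
    \<or> (d = 2 \<and> \<alpha> = 1 \<and> half_odd_integer ((of_int \<beta>0 + 2) / of_int \<beta>1))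
    \<or> (d = 2 \<and> \<alpha> = 2 \<and> half_odd_integer ((of_int \<beta>0 + 1) / of_int \<beta>1))
    \<or> (d = 2 \<and> \<alpha> = 4 \<and> (2 * of_int \<beta>0 + 1) / of_int \<beta>1 \<in> (\<int> :: real set))"
proof -
  obtain n where d: "d = Suc n" using assms(4) by (cases d) auto
  define F G where "F = poly (fib_poly d) \<alpha>" and "G = poly (fib_poly n) \<alpha>"
  have "F > 0" unfolding F_def using assms(1,4) by (intro poly_fib_poly_pos) auto
  have "poly (lucas_poly d) \<alpha> = \<alpha> * F + 2 * G"
    unfolding F_def G_def d lucas_poly_Suc by simp
  then have \<sigma>: "\<sigma> = (of_int \<beta>0 + 2 * of_int G / of_int F) / of_int \<beta>1"
    using assms(3) \<open>F > 0\<close> unfolding assms(5) F_def[symmetric] by (simp add: field_simps)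

  have cases: "d = 3 \<and> \<alpha> = 1 \<or> d = 2 \<and> \<alpha> \<in> {1, 2, 4}" if half: "half_odd_integer \<sigma>"
  proof -
    from half obtain m where "\<sigma> = of_int m / 2"
      unfolding half_odd_integer_def by blast
    \<comment> \<open>Clearing denominators in \<sigma> = \<open>m / 2\<close> gives an integer
      identity that exhibits \<open>F\<close> as a factor of \<open>4 * G\<close>.\<close>
    then have "real_of_int (4 * G) = of_int (F * (m * \<beta>1 - 2 * \<beta>0))"
      using \<sigma> assms(3) \<open>F > 0\<close> by (simp add: field_simps)
    then have "4 * G = F * (m * \<beta>1 - 2 * \<beta>0)" by (simp only: of_int_eq_iff)
    then have "F dvd 4 * G" by simp
    moreover have "coprime F G"
      unfolding F_def G_def d by (rule coprime_poly_fib_poly_Suc)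
    ultimately have "F dvd 4" by (simp add: coprime_dvd_mult_left_iff)
    then show ?thesis
      using poly_fib_poly_dvd_4_cases assms(1,4) unfolding F_def by blast
  qed

  \<comment> \<open>For \<open>d = 2\<close> and \<alpha> = 4 the quotient \<open>2 * G / F\<close>
    is 1/2. Doubling gives the right-hand fraction; if that is an integer, it divides the odd number
    \<open>2 * \<beta>0 + 1\<close> and so is odd.\<close>
  have four: "half_odd_integer ((of_int \<beta>0 + 1 / 2) / of_int \<beta>1) \<longleftrightarrow>
      (2 * of_int \<beta>0 + 1) / of_int \<beta>1 \<in> (\<int> :: real set)"
    (is "?L \<longleftrightarrow> ?R")
  proof -
    have scale: "(of_int \<beta>0 + 1 / 2) / of_int \<beta>1 = real_of_int m / 2 \<longleftrightarrow>
        (2 * of_int \<beta>0 + 1) / of_int \<beta>1 = real_of_int m" for m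
      using assms(3) by (auto simp: field_simps)
    have "odd m" if "(2 * of_int \<beta>0 + 1) / of_int \<beta>1 = real_of_int m" for m
    proof -
      have "real_of_int (2 * \<beta>0 + 1) = of_int (m * \<beta>1)"
        using that assms(3) by (simp add: field_simps)
      then have "2 * \<beta>0 + 1 = m * \<beta>1" by (simp only: of_int_eq_iff)
      then show ?thesis by (metis dvd_mult2 dvd_triv_left even_plus_one_iff)
    qed
    then show ?thesis unfolding half_odd_integer_def scale Ints_def by auto
  qed

  \<comment> \<open>Here \<open>G = 1\<close> and \<open>F = 2\<close>. For \<open>d = 2\<close> one
    has \<open>G = 1\<close> and \<open>F = \<alpha>\<close>, so the summand 2/\<alpha> is 2, 1 or
    1/2 in the three remaining cases.\<close>
  have "\<sigma> = (of_int \<beta>0 + 1) / of_int \<beta>1" if "d = 3" "\<alpha> = 1"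
    using \<sigma> that d by (simp add: F_def G_def numeral_eq_Suc)
  moreover have "\<sigma> = (of_int \<beta>0 + 2 / of_int \<alpha>) / of_int \<beta>1" if "d = 2"
    using \<sigma> that d by (simp add: F_def G_def numeral_eq_Suc)
  ultimately show ?thesis using cases four by auto
qed

end
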